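(* Let $(X,\le)$ be a partially ordered set, $R$ a commutative $2$-torsionfree unital ring and $A$ an associative $R$-algebra. Let $\varphi:FI(X,R)\to A$ be a Jordan isomorphism. Then $\varphi$ is the near-sum of $\tilde\psi$ and $\tilde\theta$ with respect to the subalgebra $D(X,R)$ and the ideal $FZ(X,R)$, where $\tilde\psi,\tilde\theta:FI(X,R)\to A$ are the maps associated with $\varphi$ as follows. For $f\in D(X,R)$ put $\tilde\psi(f)=\tilde\theta(f)=\varphi(f)$. For $f\in FZ(X,R)$ put $\tilde\psi(f)=\varphi(g)$ and $\tilde\theta(f)=\varphi(h)$, where $g,h\in FZ(X,R)$ are given, for $x\le y$, by $$g(x,y)=\varphi^{-1}\big(\varphi(e_x)\varphi(f)\varphi(e_y)\big)(x,y),\qquad h(x,y)=\varphi^{-1}\big(\varphi(e_y)\varphi(f)\varphi(e_x)\big)(x,y).$$ For general $f=f_D+f_Z$ with $f_D\in D(X,R)$, $f_Z\in FZ(X,R)$ put $\tilde\psi(f)=\varphi(f_D)+\tilde\psi(f_Z)$ and $\tilde\theta(f)=\varphi(f_D)+\tilde\theta(f_Z)$.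
   Context: $X$ is an arbitrary partially ordered set, not necessarily locally finite. $I(X,R)$ is the $R$-module of all functions $f:X\times X\to R$ with $f(x,y)=0$ whenever $x\not\le y$. $FI(X,R)$ (the finitary incidence algebra) is the $R$-submodule of those $f\in I(X,R)$ such that for every $x\le y$ there are only finitely many pairs $u<v$ with $[u,v]\subseteq[x,y]$ and $f(u,v)\ne 0$; it is an associative unital $R$-algebra under the convolution $(fg)(x,y)=\sum_{x\le z\le y}f(x,z)g(z,y)$. $D(X,R)$ is the commutative subalgebra of diagonal elements ($f(x,y)=0$ for $x\ne y$), and $FZ(X,R)$ is the ideal of those $f\in FI(X,R)$ with $f(x,x)=0$ for all $x$; $FI(X,R)=D(X,R)\oplus FZ(X,R)$ as $R$-modules. $e_x$ denotes the element with $e_x(x,x)=1$ and value $0$ at all other pairs. (The functions $g,h$ in the claim are defined to be $0$ at $(x,y)$ with $x\not\le y$; they belong to $FZ(X,R)$.) $2$-torsionfree: $2r=0$ implies $r=0$. For $R$-algebras $B,C$, a Jordan homomorphism is an $R$-linear map $\varphi:B\to C$ with $\varphi(a^2)=\varphi(a)^2$ and $\varphi(aba)=\varphi(a)\varphi(b)\varphi(a)$ for all $a,b\in B$; a Jordan isomorphism is a bijective Jordan homomorphism. Homomorphisms and anti-homomorphisms of $R$-algebras are $R$-linear. Near-sum: let $B=B_0\oplus B_1$ as $R$-modules with $B_0$ a subalgebra and $B_1$ an ideal of $B$. Let $\psi:B\to C$ be a homomorphism and $\theta:B\to C$ an anti-homomorphism such that $\psi|_{B_0}=\theta|_{B_0}$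 and $\psi(a)\theta(b)=\theta(a)\psi(b)=0$ for all $a,b\in B_1$. The near-sum of $\psi$ and $\theta$ with respect to $B_0$ and $B_1$ is the $R$-linear map $\varphi:B\to C$ with $\varphi|_{B_0}=\psi|_{B_0}=\theta|_{B_0}$ and $\varphi|_{B_1}=\psi|_{B_1}+\theta|_{B_1}$. Thus saying that $\varphi$ is the near-sum of $\psi$ and $\theta$ includes the assertion that $\psi,\theta$ satisfy all these requirements. *)

theory Defs
  imports Complex_Main
begin

section \<open>Algebras over a commutative ring\<close>

definition two_torsionfree :: "'b::comm_ring_1 itself \<Rightarrow> bool" where
  "two_torsionfree _ \<longleftrightarrow> (\<forall>r::'b. 2 * r = 0 \<longrightarrow> r = 0)"

text \<open>The class \<open>ring\<close> is associative and does not ask for a unit.\<close>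

locale assoc_algebra = module scale
  for scale :: "'r::comm_ring_1 \<Rightarrow> 'b::ring \<Rightarrow> 'b" +
  assumes scale_mult_left: "scale r a * b = scale r (a * b)"
    and scale_mult_right: "a * scale r b = scale r (a * b)"

definition algebra_hom ::
  "('r::comm_ring_1 \<Rightarrow> 'b::ring \<Rightarrow> 'b) \<Rightarrow> ('r \<Rightarrow> 'c::ring \<Rightarrow> 'c) \<Rightarrow> ('b \<Rightarrow> 'c) \<Rightarrow> bool" where
  "algebra_hom sB sC \<psi> \<longleftrightarrow>
     module_hom sB sC \<psi> \<and> (\<forall>a b. \<psi> (a * b) = \<psi> a * \<psi> b)"

definition algebra_antihom ::
  "('r::comm_ring_1 \<Rightarrow> 'b::ring \<Rightarrow> 'b) \<Rightarrow> ('r \<Rightarrow> 'c::ring \<Rightarrow> 'c) \<Rightarrow> ('b \<Rightarrow> 'c) \<Rightarrow> bool" where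
  "algebra_antihom sB sC \<theta> \<longleftrightarrow>
     module_hom sB sC \<theta> \<and> (\<forall>a b. \<theta> (a * b) = \<theta> b * \<theta> a)"

definition jordan_hom ::
  "('r::comm_ring_1 \<Rightarrow> 'b::ring \<Rightarrow> 'b) \<Rightarrow> ('r \<Rightarrow> 'c::ring \<Rightarrow> 'c) \<Rightarrow> ('b \<Rightarrow> 'c) \<Rightarrow> bool" where
  "jordan_hom sB sC \<phi> \<longleftrightarrow>
     module_hom sB sC \<phi> \<and>
     (\<forall>a. \<phi> (a * a) = \<phi> a * \<phi> a) \<and>
     (\<forall>a b. \<phi> (a * b * a) = \<phi> a * \<phi> b * \<phi> a)"

definition jordan_iso ::
  "('r::comm_ring_1 \<Rightarrow> 'b::ring \<Rightarrow> 'b) \<Rightarrow> ('r \<Rightarrow> 'c::ring \<Rightarrow> 'c) \<Rightarrow> ('b \<Rightarrow> 'c) \<Rightarrow> bool" where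
  "jordan_iso sB sC \<phi> \<longleftrightarrow> jordan_hom sB sC \<phi> \<and> bij \<phi>"

definition is_subalgebra :: "('r::comm_ring_1 \<Rightarrow> 'b::ring \<Rightarrow> 'b) \<Rightarrow> 'b set \<Rightarrow> bool" where
  "is_subalgebra sB S \<longleftrightarrow> module.subspace sB S \<and> (\<forall>a\<in>S. \<forall>b\<in>S. a * b \<in> S)"

definition is_ideal :: "('r::comm_ring_1 \<Rightarrow> 'b::ring \<Rightarrow> 'b) \<Rightarrow> 'b set \<Rightarrow> bool" where
  "is_ideal sB I \<longleftrightarrow> module.subspace sB I \<and> (\<forall>a\<in>I. \<forall>b. a * b \<in> I \<and> b * a \<in> I)"

definition direct_sum_decomposition :: "'b::ab_group_add set \<Rightarrow> 'b set \<Rightarrow> bool" where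
  "direct_sum_decomposition B0 B1 \<longleftrightarrow>
     B0 \<inter> B1 = {0} \<and> (\<forall>b. \<exists>b0\<in>B0. \<exists>b1\<in>B1. b = b0 + b1)"

text \<open>\<open>is_near_sum sB sC B0 B1 \<psi> \<theta> \<phi>\<close>: the near-sum of \<open>\<psi>\<close> and \<open>\<theta>\<close> with respect to \<open>B0\<close>
  and \<open>B1\<close> is defined and equals \<open>\<phi>\<close>.\<close>

definition is_near_sum ::
  "('r::comm_ring_1 \<Rightarrow> 'b::ring \<Rightarrow> 'b) \<Rightarrow> ('r \<Rightarrow> 'c::ring \<Rightarrow> 'c) \<Rightarrow> 'b set \<Rightarrow> 'b set \<Rightarrow>
     ('b \<Rightarrow> 'c) \<Rightarrow> ('b \<Rightarrow> 'c) \<Rightarrow> ('b \<Rightarrow> 'c) \<Rightarrow> bool" where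
  "is_near_sum sB sC B0 B1 \<psi> \<theta> \<phi> \<longleftrightarrow>
     is_subalgebra sB B0 \<and> is_ideal sB B1 \<and> direct_sum_decomposition B0 B1 \<and>
     algebra_hom sB sC \<psi> \<and> algebra_antihom sB sC \<theta> \<and>
     (\<forall>a\<in>B0. \<psi> a = \<theta> a) \<and>
     (\<forall>a\<in>B1. \<forall>b\<in>B1. \<psi> a * \<theta> b = 0 \<and> \<theta> a * \<psi> b = 0) \<and>
     module_hom sB sC \<phi> \<and>
     (\<forall>a\<in>B0. \<phi> a = \<psi> a) \<and>
     (\<forall>a\<in>B1. \<phi> a = \<psi> a + \<theta> a)"


section \<open>The finitary incidence algebra\<close>

definition incidence_fun :: "('x::order \<Rightarrow> 'x \<Rightarrow> 'r::zero) \<Rightarrow> bool" where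
  "incidence_fun f \<longleftrightarrow> (\<forall>x y. \<not> x \<le> y \<longrightarrow> f x y = 0)"

definition support_pairs :: "('x::order \<Rightarrow> 'x \<Rightarrow> 'r::zero) \<Rightarrow> 'x \<Rightarrow> 'x \<Rightarrow> ('x \<times> 'x) set" where
  "support_pairs f x y = {(u, v). u < v \<and> {u..v} \<subseteq> {x..y} \<and> f u v \<noteq> 0}"

definition finitary_fun :: "('x::order \<Rightarrow> 'x \<Rightarrow> 'r::zero) \<Rightarrow> bool" where
  "finitary_fun f \<longleftrightarrow>
     incidence_fun f \<and> (\<forall>x y. x \<le> y \<longrightarrow> finite (support_pairs f x y))"

text \<open>Intervals may be infinite, so the sum runs over the indices with nonzero summand; for
  finitary \<open>f\<close> and \<open>g\<close> there are finitely many of them.\<close>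

definition convolution ::
  "('x::order \<Rightarrow> 'x \<Rightarrow> 'r::semiring_0) \<Rightarrow> ('x \<Rightarrow> 'x \<Rightarrow> 'r) \<Rightarrow> 'x \<Rightarrow> 'x \<Rightarrow> 'r" where
  "convolution f g x y = (\<Sum>z | x \<le> z \<and> z \<le> y \<and> f x z * g z y \<noteq> 0. f x z * g z y)"

lemma finitary_fun_subset:
  assumes "finitary_fun f" "finitary_fun g" "incidence_fun h"
    and "\<And>x y. x < y \<Longrightarrow> h x y \<noteq> 0 \<Longrightarrow> f x y \<noteq> 0 \<or> g x y \<noteq> 0"
  shows "finitary_fun h"
  unfolding finitary_fun_def
proof (intro conjI allI impI)
  show "incidence_fun h" by fact
next
  fix x y :: 'a assume xy: "x \<le> y"
  have "support_pairs h x y \<subseteq> support_pairs f x y \<union> support_pairs g x y"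
    using assms(4) by (auto simp: support_pairs_def)
  then show "finite (support_pairs h x y)"
    using assms(1,2) xy unfolding finitary_fun_def by (meson finite_UnI finite_subset)
qed

definition hull_set :: "('x::order \<Rightarrow> 'x \<Rightarrow> 'r::zero) \<Rightarrow> 'x \<Rightarrow> 'x \<Rightarrow> 'x set" where
  "hull_set f x y = {x, y} \<union> fst ` support_pairs f x y \<union> snd ` support_pairs f x y"

lemma finite_hull_set: "finitary_fun f \<Longrightarrow> x \<le> y \<Longrightarrow> finite (hull_set f x y)"
  by (simp add: hull_set_def finitary_fun_def)

lemma hull_set_mem:
  assumes "u < v" "x \<le> u" "v \<le> y" "f u v \<noteq> 0"
  shows "u \<in> hull_set f x y" "v \<in> hull_set f x y"
proof -
  have "(u, v) \<in> support_pairs f x y" using assms by (auto simp: support_pairs_def)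
  then show "u \<in> hull_set f x y" "v \<in> hull_set f x y"
    unfolding hull_set_def by force+
qed

lemma hull_set_le:
  assumes "x \<le> y" "z \<in> hull_set f x y"
  shows "x \<le> z \<and> z \<le> y"
proof -
  have "x \<le> u \<and> u \<le> y \<and> x \<le> v \<and> v \<le> y" if "(u, v) \<in> support_pairs f x y" for u v
  proof -
    have "u \<le> v" "{u..v} \<subseteq> {x..y}" using that by (auto simp: support_pairs_def)
    then have "u \<in> {x..y}" "v \<in> {x..y}" by (meson atLeastAtMost_iff order_refl subsetD)+
    then show ?thesis by simp
  qed
  then show ?thesis using assms by (auto simp: hull_set_def)
qed

lemma convolution_eq_sum:
  fixes f g :: "'x::order \<Rightarrow> 'x \<Rightarrow> 'r::comm_ring_1"
  assumes f: "incidence_fun f" and g: "incidence_fun g" and S: "finite S"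
    and sup: "\<And>z. x \<le> z \<Longrightarrow> z \<le> y \<Longrightarrow> f x z \<noteq> 0 \<Longrightarrow> g z y \<noteq> 0 \<Longrightarrow> z \<in> S"
  shows "convolution f g x y = (\<Sum>z\<in>S. f x z * g z y)"
  unfolding convolution_def
proof (rule sum.mono_neutral_left)
  show "finite S" by fact
  show "{z. x \<le> z \<and> z \<le> y \<and> f x z * g z y \<noteq> 0} \<subseteq> S"
  proof
    fix z assume "z \<in> {z. x \<le> z \<and> z \<le> y \<and> f x z * g z y \<noteq> 0}"
    then have "x \<le> z" "z \<le> y" "f x z \<noteq> 0" "g z y \<noteq> 0" by auto
    then show "z \<in> S" by (rule sup)
  qed
  show "\<forall>z\<in>S - {z. x \<le> z \<and> z \<le> y \<and> f x z * g z y \<noteq> 0}. f x z * g z y = 0"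
  proof
    fix z assume "z \<in> S - {z. x \<le> z \<and> z \<le> y \<and> f x z * g z y \<noteq> 0}"
    then consider "\<not> x \<le> z" | "\<not> z \<le> y" | "f x z * g z y = 0" by blast
    then show "f x z * g z y = 0"
      using f g by cases (simp_all add: incidence_fun_def)
  qed
qed

lemma convolution_nonzero:
  assumes "convolution f g x y \<noteq> 0"
  obtains z where "x \<le> z" "z \<le> y" "f x z \<noteq> 0" "g z y \<noteq> 0"
proof -
  have "{z. x \<le> z \<and> z \<le> y \<and> f x z * g z y \<noteq> 0} \<noteq> {}"
    using assms unfolding convolution_def by (metis (no_types, lifting) sum.empty)
  then show ?thesis using that by force
qed

lemma incidence_fun_convolution: "incidence_fun (convolution f g)"
  unfolding incidence_fun_def
proof (intro allI impI)
  fix x y :: 'a assume xy: "\<not> x \<le> y"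
  have "x \<le> y" if "convolution f g x y \<noteq> 0"
    using that by (elim convolution_nonzero) (rule order_trans)
  then show "convolution f g x y = 0" using xy by blast
qed

lemma convolution_outside: "\<not> x \<le> y \<Longrightarrow> convolution f g x y = 0"
  using incidence_fun_convolution unfolding incidence_fun_def by blast

lemma finitary_fun_convolution:
  assumes f: "finitary_fun f" and g: "finitary_fun g"
  shows "finitary_fun (convolution f g)"
  unfolding finitary_fun_def
proof (intro conjI allI impI incidence_fun_convolution)
  fix x y :: 'a assume xy: "x \<le> y"
  define S where "S = hull_set f x y \<union> hull_set g x y"
  have "support_pairs (convolution f g) x y \<subseteq> S \<times> S"
  proof (rule subrelI)
    fix u v assume "(u, v) \<in> support_pairs (convolution f g) x y"
    then have uv: "u < v" "x \<le> u" "v \<le> y" and nz: "convolution f g u v \<noteq> 0"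
      by (auto simp: support_pairs_def)
    from nz obtain z where z: "u \<le> z" "z \<le> v" "f u z \<noteq> 0" "g z v \<noteq> 0"
      by (rule convolution_nonzero)
    have "u \<in> S"
    proof (cases "u = z")
      case True
      then show ?thesis using hull_set_mem[of u v x y g] uv z by (auto simp: S_def)
    next
      case False
      then show ?thesis using hull_set_mem[of u z x y f] uv z by (auto simp: S_def)
    qed
    moreover have "v \<in> S"
    proof (cases "v = z")
      case True
      then show ?thesis using hull_set_mem[of u v x y f] uv z by (auto simp: S_def)
    next
      case False
      then show ?thesis using hull_set_mem[of z v x y g] uv z by (auto simp: S_def)
    qed
    ultimately show "(u, v) \<in> S \<times> S" by simp
  qed
  moreover have "finite S" using f g xy by (simp add: S_def finite_hull_set)
  ultimately show "finite (support_pairs (convolution f g) x y)"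
    by (meson finite_SigmaI finite_subset)
qed

lemma convolution_assoc:
  fixes f g h :: "'x::order \<Rightarrow> 'x \<Rightarrow> 'r::comm_ring_1"
  assumes f: "finitary_fun f" and g: "finitary_fun g" and h: "finitary_fun h"
  shows "convolution (convolution f g) h x y = convolution f (convolution g h) x y"
proof (cases "x \<le> y")
  case False
  then show ?thesis by (simp add: convolution_outside)
next
  case True
  define S where "S = hull_set f x y \<union> hull_set g x y \<union> hull_set h x y"
  have S: "finite S" using f g h True by (simp add: S_def finite_hull_set)
  have xyS: "x \<in> S" "y \<in> S" by (auto simp: S_def hull_set_def)
  have fS: "z \<in> S" if "x \<le> z" "z \<le> y" "f x z \<noteq> 0" for z
    using that xyS hull_set_mem(2)[of x z x y f] by (cases "x = z") (auto simp: S_def)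
  have hS: "z \<in> S" if "x \<le> z" "z \<le> y" "h z y \<noteq> 0" for z
    using that xyS hull_set_mem(1)[of z y x y h] by (cases "z = y") (auto simp: S_def)
  have inc: "incidence_fun f" "incidence_fun g" "incidence_fun h"
    using f g h by (auto simp: finitary_fun_def)
  have le: "x \<le> z \<and> z \<le> y" if "z \<in> S" for z
    using that hull_set_le[OF True] by (auto simp: S_def)
  have fg: "convolution f g x z = (\<Sum>w\<in>S. f x w * g w z)" if "z \<in> S" for z
    by (rule convolution_eq_sum[OF inc(1,2) S]) (use fS le[OF that] order_trans in blast)
  have gh: "convolution g h w y = (\<Sum>z\<in>S. g w z * h z y)" if "w \<in> S" for w
    by (rule convolution_eq_sum[OF inc(2,3) S]) (use hS le[OF that] order_trans in blast)
  have "convolution (convolution f g) h x y = (\<Sum>z\<in>S. convolution f g x z * h z y)"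
    by (rule convolution_eq_sum[OF incidence_fun_convolution inc(3) S]) (rule hS)
  also have "\<dots> = (\<Sum>z\<in>S. \<Sum>w\<in>S. f x w * (g w z * h z y))"
    by (simp add: fg sum_distrib_right mult.assoc)
  also have "\<dots> = (\<Sum>w\<in>S. \<Sum>z\<in>S. f x w * (g w z * h z y))"
    by (rule sum.swap)
  also have "\<dots> = (\<Sum>w\<in>S. f x w * convolution g h w y)"
    by (simp add: gh sum_distrib_left)
  also have "\<dots> = convolution f (convolution g h) x y"
    by (rule convolution_eq_sum[OF inc(1) incidence_fun_convolution S, symmetric]) (rule fS)
  finally show ?thesis .
qed

lemma convolution_add_left:
  fixes f g h :: "'x::order \<Rightarrow> 'x \<Rightarrow> 'r::comm_ring_1"
  assumes f: "finitary_fun f" and g: "finitary_fun g" and h: "finitary_fun h"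
  shows "convolution (\<lambda>x y. f x y + g x y) h x y = convolution f h x y + convolution g h x y"
proof (cases "x \<le> y")
  case False
  then show ?thesis by (simp add: convolution_outside)
next
  case True
  have inc: "incidence_fun f" "incidence_fun g" "incidence_fun h"
    using f g h by (auto simp: finitary_fun_def)
  then have inc': "incidence_fun (\<lambda>x y. f x y + g x y)" by (simp add: incidence_fun_def)
  have S: "finite (hull_set h x y)" using h True by (rule finite_hull_set)
  have hS: "z \<in> hull_set h x y" if "x \<le> z" "z \<le> y" "h z y \<noteq> 0" for z
    using that hull_set_mem(1)[of z y x y h] by (cases "z = y") (auto simp: hull_set_def)
  show ?thesis
    using convolution_eq_sum[OF inc(1,3) S, of x y] convolution_eq_sum[OF inc(2,3) S, of x y]
      convolution_eq_sum[OF inc' inc(3) S, of x y] hS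
    by (simp add: sum.distrib distrib_right)
qed

lemma convolution_add_right:
  fixes f g h :: "'x::order \<Rightarrow> 'x \<Rightarrow> 'r::comm_ring_1"
  assumes f: "finitary_fun f" and g: "finitary_fun g" and h: "finitary_fun h"
  shows "convolution f (\<lambda>x y. g x y + h x y) x y = convolution f g x y + convolution f h x y"
proof (cases "x \<le> y")
  case False
  then show ?thesis by (simp add: convolution_outside)
next
  case True
  have inc: "incidence_fun f" "incidence_fun g" "incidence_fun h"
    using f g h by (auto simp: finitary_fun_def)
  then have inc': "incidence_fun (\<lambda>x y. g x y + h x y)" by (simp add: incidence_fun_def)
  have S: "finite (hull_set f x y)" using f True by (rule finite_hull_set)
  have fS: "z \<in> hull_set f x y" if "x \<le> z" "z \<le> y" "f x z \<noteq> 0" for z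
    using that hull_set_mem(2)[of x z x y f] by (cases "x = z") (auto simp: hull_set_def)
  show ?thesis
    using convolution_eq_sum[OF inc(1,2) S, of x y] convolution_eq_sum[OF inc(1,3) S, of x y]
      convolution_eq_sum[OF inc(1) inc' S, of x y] fS
    by (simp add: sum.distrib distrib_left)
qed

lemma convolution_scale_left:
  fixes f g :: "'x::order \<Rightarrow> 'x \<Rightarrow> 'r::comm_ring_1"
  assumes f: "finitary_fun f" and g: "finitary_fun g"
  shows "convolution (\<lambda>x y. r * f x y) g x y = r * convolution f g x y"
proof (cases "x \<le> y")
  case False
  then show ?thesis by (simp add: convolution_outside)
next
  case True
  have inc: "incidence_fun f" "incidence_fun g"
    using f g by (auto simp: finitary_fun_def)
  then have inc': "incidence_fun (\<lambda>x y. r * f x y)" by (simp add: incidence_fun_def)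
  have S: "finite (hull_set g x y)" using g True by (rule finite_hull_set)
  have gS: "z \<in> hull_set g x y" if "x \<le> z" "z \<le> y" "g z y \<noteq> 0" for z
    using that hull_set_mem(1)[of z y x y g] by (cases "z = y") (auto simp: hull_set_def)
  show ?thesis
    using convolution_eq_sum[OF inc S, of x y] convolution_eq_sum[OF inc' inc(2) S, of x y] gS
    by (simp add: sum_distrib_left mult.assoc)
qed

lemma convolution_scale_right:
  fixes f g :: "'x::order \<Rightarrow> 'x \<Rightarrow> 'r::comm_ring_1"
  assumes f: "finitary_fun f" and g: "finitary_fun g"
  shows "convolution f (\<lambda>x y. r * g x y) x y = r * convolution f g x y"
proof (cases "x \<le> y")
  case False
  then show ?thesis by (simp add: convolution_outside)
next
  case True
  have inc: "incidence_fun f" "incidence_fun g"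
    using f g by (auto simp: finitary_fun_def)
  then have inc': "incidence_fun (\<lambda>x y. r * g x y)" by (simp add: incidence_fun_def)
  have S: "finite (hull_set f x y)" using f True by (rule finite_hull_set)
  have fS: "z \<in> hull_set f x y" if "x \<le> z" "z \<le> y" "f x z \<noteq> 0" for z
    using that hull_set_mem(2)[of x z x y f] by (cases "x = z") (auto simp: hull_set_def)
  show ?thesis
    using convolution_eq_sum[OF inc S, of x y] convolution_eq_sum[OF inc(1) inc' S, of x y] fS
    by (simp add: sum_distrib_left mult.left_commute)
qed

lemma convolution_one_left:
  fixes f :: "'x::order \<Rightarrow> 'x \<Rightarrow> 'r::comm_ring_1"
  assumes "incidence_fun f"
  shows "convolution (\<lambda>x y. if x = y then 1 else 0) f x y = f x y"
proof -
  have "convolution (\<lambda>x y. if x = y then 1 else 0) f x y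
      = (\<Sum>z\<in>{x}. (if x = z then 1 else 0) * f z y)"
    by (rule convolution_eq_sum) (use assms in \<open>auto simp: incidence_fun_def split: if_splits\<close>)
  then show ?thesis by simp
qed

lemma convolution_one_right:
  fixes f :: "'x::order \<Rightarrow> 'x \<Rightarrow> 'r::comm_ring_1"
  assumes "incidence_fun f"
  shows "convolution f (\<lambda>x y. if x = y then 1 else 0) x y = f x y"
proof -
  have "convolution f (\<lambda>x y. if x = y then 1 else 0) x y
      = (\<Sum>z\<in>{y}. f x z * (if z = y then 1 else 0))"
    by (rule convolution_eq_sum) (use assms in \<open>auto simp: incidence_fun_def split: if_splits\<close>)
  then show ?thesis by simp
qed

lemma finitary_fun_diagonal:
  "(\<And>x y. x \<noteq> y \<Longrightarrow> f x y = 0) \<Longrightarrow> finitary_fun f"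
proof -
  assume f: "\<And>x y. x \<noteq> y \<Longrightarrow> f x y = 0"
  have "support_pairs f x y = {}" for x y
    using f by (force simp: support_pairs_def)
  moreover have "incidence_fun f"
    unfolding incidence_fun_def using f by (metis order_refl)
  ultimately show "finitary_fun f" by (simp add: finitary_fun_def)
qed

text \<open>The poset and the coefficient ring are types, so \<open>FI(X,R)\<close> is a type too.\<close>

typedef (overloaded) ('x, 'r) fi =
  "{f :: 'x::order \<Rightarrow> 'x \<Rightarrow> 'r::comm_ring_1. finitary_fun f}"
  morphisms entry Abs_fi
  by (rule exI[of _ "\<lambda>_ _. 0"]) (simp add: finitary_fun_diagonal)

setup_lifting type_definition_fi

lemma fi_eqI: "(\<And>x y. entry f x y = entry g x y) \<Longrightarrow> f = g"
  by (metis entry_inject ext)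

instantiation fi :: (order, comm_ring_1) ring_1
begin

lift_definition zero_fi :: "('a, 'b) fi" is "\<lambda>_ _. 0"
  by (simp add: finitary_fun_diagonal)

lift_definition one_fi :: "('a, 'b) fi" is "\<lambda>x y. if x = y then 1 else 0"
  by (simp add: finitary_fun_diagonal)

lift_definition plus_fi :: "('a, 'b) fi \<Rightarrow> ('a, 'b) fi \<Rightarrow> ('a, 'b) fi"
  is "\<lambda>f g x y. f x y + g x y"
proof -
  fix f g :: "'a \<Rightarrow> 'a \<Rightarrow> 'b"
  assume fg: "finitary_fun f" "finitary_fun g"
  show "finitary_fun (\<lambda>x y. f x y + g x y)"
    by (rule finitary_fun_subset[OF fg]) (use fg in \<open>auto simp: finitary_fun_def incidence_fun_def\<close>)
qed

lift_definition uminus_fi :: "('a, 'b) fi \<Rightarrow> ('a, 'b) fi" is "\<lambda>f x y. - f x y"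
proof -
  fix f :: "'a \<Rightarrow> 'a \<Rightarrow> 'b"
  assume f: "finitary_fun f"
  show "finitary_fun (\<lambda>x y. - f x y)"
    by (rule finitary_fun_subset[OF f f]) (use f in \<open>auto simp: finitary_fun_def incidence_fun_def\<close>)
qed

lift_definition minus_fi :: "('a, 'b) fi \<Rightarrow> ('a, 'b) fi \<Rightarrow> ('a, 'b) fi"
  is "\<lambda>f g x y. f x y - g x y"
proof -
  fix f g :: "'a \<Rightarrow> 'a \<Rightarrow> 'b"
  assume fg: "finitary_fun f" "finitary_fun g"
  show "finitary_fun (\<lambda>x y. f x y - g x y)"
    by (rule finitary_fun_subset[OF fg]) (use fg in \<open>auto simp: finitary_fun_def incidence_fun_def\<close>)
qed

lift_definition times_fi :: "('a, 'b) fi \<Rightarrow> ('a, 'b) fi \<Rightarrow> ('a, 'b) fi" is convolution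
  by (rule finitary_fun_convolution)

instance
proof
  fix a b c :: "('a, 'b) fi"
  show "a * b * c = a * (b * c)"
    by transfer (simp add: fun_eq_iff convolution_assoc)
  show "a + b + c = a + (b + c)" by transfer (simp add: fun_eq_iff)
  show "a + b = b + a" by transfer (simp add: fun_eq_iff)
  show "0 + a = a" by transfer (simp add: fun_eq_iff)
  show "- a + a = 0" by transfer (simp add: fun_eq_iff)
  show "a - b = a + - b" by transfer (simp add: fun_eq_iff)
  show "1 * a = a"
    by transfer (simp add: fun_eq_iff convolution_one_left finitary_fun_def)
  show "a * 1 = a"
    by transfer (simp add: fun_eq_iff convolution_one_right finitary_fun_def)
  show "(a + b) * c = a * c + b * c"
    by transfer (simp add: fun_eq_iff convolution_add_left)
  show "a * (b + c) = a * b + a * c"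
    by transfer (simp add: fun_eq_iff convolution_add_right)
  show "(0::('a, 'b) fi) \<noteq> 1"
    by transfer (metis zero_neq_one)
qed

end

lift_definition scale_fi :: "'r::comm_ring_1 \<Rightarrow> ('x::order, 'r) fi \<Rightarrow> ('x, 'r) fi"
  is "\<lambda>r f x y. r * f x y"
proof -
  fix r :: 'r and f :: "'x \<Rightarrow> 'x \<Rightarrow> 'r"
  assume "finitary_fun f"
  then show "finitary_fun (\<lambda>x y. r * f x y)"
    by (intro finitary_fun_subset[of f f "\<lambda>x y. r * f x y"])
      (auto simp: finitary_fun_def incidence_fun_def)
qed

interpretation fi: assoc_algebra "scale_fi :: 'r::comm_ring_1 \<Rightarrow> ('x::order, 'r) fi \<Rightarrow> ('x, 'r) fi"
proof
  fix r s :: 'r and a b :: "('x, 'r) fi"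
  show "scale_fi r (a + b) = scale_fi r a + scale_fi r b"
    by transfer (simp add: fun_eq_iff distrib_left)
  show "scale_fi (r + s) a = scale_fi r a + scale_fi s a"
    by transfer (simp add: fun_eq_iff distrib_right)
  show "scale_fi r (scale_fi s a) = scale_fi (r * s) a"
    by transfer (simp add: fun_eq_iff mult.assoc)
  show "scale_fi 1 a = a" by transfer simp
  show "scale_fi r a * b = scale_fi r (a * b)"
    by transfer (simp add: fun_eq_iff convolution_scale_left)
  show "a * scale_fi r b = scale_fi r (a * b)"
    by transfer (simp add: fun_eq_iff convolution_scale_right)
qed

definition fi_D :: "('x::order, 'r::comm_ring_1) fi set" where
  "fi_D = {f. \<forall>x y. x \<noteq> y \<longrightarrow> entry f x y = 0}"

definition fi_FZ :: "('x::order, 'r::comm_ring_1) fi set" where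
  "fi_FZ = {f. \<forall>x. entry f x x = 0}"

lift_definition idem :: "'x::order \<Rightarrow> ('x, 'r::comm_ring_1) fi"
  is "\<lambda>x u v. if u = x \<and> v = x then 1 else 0"
  by (rule finitary_fun_diagonal) auto

lift_definition diag_part :: "('x::order, 'r::comm_ring_1) fi \<Rightarrow> ('x, 'r) fi"
  is "\<lambda>f x y. if x = y then f x y else 0"
  by (rule finitary_fun_diagonal) auto

definition strict_part :: "('x::order, 'r::comm_ring_1) fi \<Rightarrow> ('x, 'r) fi" where
  "strict_part f = f - diag_part f"

lemma diag_part_in_D: "diag_part f \<in> fi_D"
  by (simp add: fi_D_def diag_part.rep_eq)

lemma strict_part_in_FZ: "strict_part f \<in> fi_FZ"
  by (simp add: fi_FZ_def strict_part_def minus_fi.rep_eq diag_part.rep_eq)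

lemma diag_part_of_D: "f \<in> fi_D \<Longrightarrow> diag_part f = f"
  by (rule fi_eqI) (simp add: fi_D_def diag_part.rep_eq)

lemma strict_part_of_FZ: "f \<in> fi_FZ \<Longrightarrow> strict_part f = f"
  by (rule fi_eqI) (simp add: fi_FZ_def strict_part_def minus_fi.rep_eq diag_part.rep_eq)


section \<open>The maps associated with a Jordan isomorphism\<close>

text \<open>\<open>psi_fun \<phi> f\<close> and \<open>theta_fun \<phi> f\<close> are the functions \<open>g\<close> and \<open>h\<close>. They are plain functions of
  two arguments; \<open>Abs_fi\<close> below is meaningful once they are known to be finitary.\<close>

definition psi_fun ::
  "(('x::order, 'r::comm_ring_1) fi \<Rightarrow> 'a::ring) \<Rightarrow> ('x, 'r) fi \<Rightarrow> 'x \<Rightarrow> 'x \<Rightarrow> 'r" where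
  "psi_fun \<phi> f x y =
     (if x \<le> y then entry (inv \<phi> (\<phi> (idem x) * \<phi> f * \<phi> (idem y))) x y else 0)"

definition theta_fun ::
  "(('x::order, 'r::comm_ring_1) fi \<Rightarrow> 'a::ring) \<Rightarrow> ('x, 'r) fi \<Rightarrow> 'x \<Rightarrow> 'x \<Rightarrow> 'r" where
  "theta_fun \<phi> f x y =
     (if x \<le> y then entry (inv \<phi> (\<phi> (idem y) * \<phi> f * \<phi> (idem x))) x y else 0)"

definition psi_tilde ::
  "(('x::order, 'r::comm_ring_1) fi \<Rightarrow> 'a::ring) \<Rightarrow> ('x, 'r) fi \<Rightarrow> 'a" where
  "psi_tilde \<phi> f = \<phi> (diag_part f) + \<phi> (Abs_fi (psi_fun \<phi> (strict_part f)))"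

definition theta_tilde ::
  "(('x::order, 'r::comm_ring_1) fi \<Rightarrow> 'a::ring) \<Rightarrow> ('x, 'r) fi \<Rightarrow> 'a" where
  "theta_tilde \<phi> f = \<phi> (diag_part f) + \<phi> (Abs_fi (theta_fun \<phi> (strict_part f)))"

end

theory Submission
  imports Defs
begin

text \<open>
  Transporting the product of \<open>A\<close> along the bijection \<open>\<phi>\<close> gives a second associative bilinear
  product \<open>f \<odot> g = \<phi>\<^sup>-\<^sup>1 (\<phi> f * \<phi> g)\<close> on \<open>FI(X,R)\<close>, and \<open>\<phi>\<close> is a Jordan homomorphism
  precisely when both products have the same squares and the same triple products \<open>aba\<close>. So the
  question is how far such a product can differ from the convolution.

  The \<open>e\<^sub>x\<close> are orthogonal idempotents for \<open>\<odot>\<close> as well. Write \<open>e\<^sub>x\<^sub>y\<close> for the matrix units.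
  For \<open>x < y\<close> the polarized triple identity reads
  \<open>e\<^sub>x \<odot> f \<odot> e\<^sub>y + e\<^sub>y \<odot> f \<odot> e\<^sub>x = f(x,y) e\<^sub>x\<^sub>y\<close>, and cutting it down to one of its two corners gives
  \<open>e\<^sub>x \<odot> f \<odot> e\<^sub>y = c(x,y) f(x,y) e\<^sub>x\<^sub>y\<close> and
  \<open>e\<^sub>y \<odot> f \<odot> e\<^sub>x = (1 - c(x,y)) f(x,y) e\<^sub>x\<^sub>y\<close>, where \<open>c(x,y) \<in> R\<close> is an idempotent depending on
  \<open>\<odot>\<close> only. Hence \<open>g\<close> and \<open>h\<close> are \<open>f\<close> multiplied entrywise by \<open>c\<close> and \<open>1 - c\<close>
  (\<open>hom_part\<close> and \<open>anti_part\<close>), which makes them finitary and linear in \<open>f\<close>, with sum \<open>f\<close> on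
  strict elements.

  Multiplicativity has two ingredients. First, \<open>c(x,z) = c(z,y) = c(x,y)\<close> for \<open>x < z < y\<close>: the
  \<open>c\<close>-part of \<open>e\<^sub>x\<^sub>z\<close> and the \<open>(1 - c)\<close>-part of \<open>e\<^sub>z\<^sub>y\<close> have zero \<open>\<odot>\<close>-products in both orders, and
  two \<open>c\<close>-parts multiply into the \<open>c\<close>-part of \<open>e\<^sub>x\<^sub>y\<close>
  (\<open>coef_chain_mixed\<close>, \<open>coef_chain_le\<close>, \<open>coef_chain\<close>); thus \<open>hom_part\<close> is multiplicative for the convolution.
  Second, an element is determined by its corners \<open>e\<^sub>x \<odot> f \<odot> e\<^sub>y\<close> (\<open>eq_if_corners_eq\<close>), and for
  \<open>x \<noteq> y\<close> the corner of a product is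
  \<open>e\<^sub>x \<odot> f \<odot> g \<odot> e\<^sub>y = (e\<^sub>x \<odot> f) * (g \<odot> e\<^sub>y) + (g \<odot> e\<^sub>y) * (e\<^sub>x \<odot> f)\<close> (\<open>corner_jmult\<close>),
  since in the other order the two factors meet in \<open>e\<^sub>y \<odot> e\<^sub>x = 0\<close>. This replaces the
  expansion over intermediate points, which would be an infinite sum. Multiplying a homomorphic
  part by an idempotent gives the same result for both products, so \<open>\<odot>\<close> and the convolution
  agree on homomorphic parts. Replacing \<open>\<odot>\<close> by its opposite exchanges \<open>c\<close> with \<open>1 - c\<close>, which
  gives the statement for antihomomorphic parts, and the same corner formula shows that mixed
  products of strict parts are zero.
\<close>


section \<open>Entries of products with idempotents and matrix units\<close>

lemma entry_outside: "\<not> x \<le> y \<Longrightarrow> entry f x y = 0"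
  using entry[of f] by (simp add: finitary_fun_def incidence_fun_def)

lemma incidence_fun_entry: "incidence_fun (entry f)"
  by (simp add: incidence_fun_def entry_outside)

lemma finitary_fun_entry: "finitary_fun (entry f)"
  using entry[of f] by simp

lemmas entry_simps = zero_fi.rep_eq plus_fi.rep_eq minus_fi.rep_eq scale_fi.rep_eq

lemma entry_idem_mult: "entry (idem x * f) u v = (if u = x then entry f x v else 0)"
proof -
  have "entry (idem x * f) u v = (\<Sum>z\<in>{x}. entry (idem x) u z * entry f z v)"
    unfolding times_fi.rep_eq
    by (rule convolution_eq_sum[OF incidence_fun_entry incidence_fun_entry])
      (auto simp: idem.rep_eq split: if_splits)
  then show ?thesis by (simp add: idem.rep_eq)
qed

lemma entry_mult_idem: "entry (f * idem y) u v = (if v = y then entry f u y else 0)"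
proof -
  have "entry (f * idem y) u v = (\<Sum>z\<in>{y}. entry f u z * entry (idem y) z v)"
    unfolding times_fi.rep_eq
    by (rule convolution_eq_sum[OF incidence_fun_entry incidence_fun_entry])
      (auto simp: idem.rep_eq split: if_splits)
  then show ?thesis by (simp add: idem.rep_eq)
qed

lemma entry_mult_idem_mult: "entry (f * idem z * g) u v = entry f u z * entry g z v"
proof -
  have "entry (f * idem z * g) u v = (\<Sum>w\<in>{z}. entry (f * idem z) u w * entry g w v)"
    unfolding times_fi.rep_eq[of "f * idem z"]
    by (rule convolution_eq_sum[OF incidence_fun_entry incidence_fun_entry])
      (auto simp: entry_mult_idem split: if_splits)
  then show ?thesis by (simp add: entry_mult_idem)
qed

lemma idem_mult_idem: "idem x * idem y = (if x = y then idem x else 0)"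
  by (rule fi_eqI) (auto simp: entry_idem_mult idem.rep_eq entry_simps)

text \<open>Zero when \<open>x \<le> y\<close> fails, so that \<open>idem x * f * idem y\<close> is a multiple of it in every case.\<close>

lift_definition matrix_unit :: "'x::order \<Rightarrow> 'x \<Rightarrow> ('x, 'r::comm_ring_1) fi"
  is "\<lambda>x y u v. if u = x \<and> v = y \<and> x \<le> y then 1 else 0"
proof -
  fix x y :: 'x
  let ?m = "\<lambda>u v. if u = x \<and> v = y \<and> x \<le> y then 1 else (0::'r)"
  have "support_pairs ?m u v \<subseteq> {(x, y)}" for u v
    by (auto simp: support_pairs_def split: if_splits)
  then show "finitary_fun ?m"
    by (auto simp: finitary_fun_def incidence_fun_def intro: finite_subset)
qed

lemma matrix_unit_self: "matrix_unit x x = idem x"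
  by (rule fi_eqI) (simp add: matrix_unit.rep_eq idem.rep_eq)

lemma idem_mult_mult_idem: "idem x * f * idem y = scale_fi (entry f x y) (matrix_unit x y)"
  by (rule fi_eqI)
    (auto simp: entry_mult_idem entry_idem_mult entry_simps matrix_unit.rep_eq entry_outside)

lemma idem_mult_matrix_unit: "idem x * matrix_unit x y = matrix_unit x y"
  by (rule fi_eqI) (auto simp: entry_idem_mult matrix_unit.rep_eq)

lemma matrix_unit_mult_idem:
  "matrix_unit x y * idem z = (if z = y then matrix_unit x y else 0)"
  by (rule fi_eqI) (auto simp: entry_mult_idem matrix_unit.rep_eq entry_simps)

lemma matrix_unit_mult:
  assumes "x \<le> z" "z \<le> y"
  shows "matrix_unit x z * matrix_unit z y = matrix_unit x y"
proof (rule fi_eqI)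
  fix u v
  have "matrix_unit x z * matrix_unit z y
      = matrix_unit x z * idem z * (matrix_unit z y :: ('a, 'b) fi)"
    by (simp add: matrix_unit_mult_idem)
  then show "entry (matrix_unit x z * matrix_unit z y) u v = (entry (matrix_unit x y) u v :: 'b)"
    using assms by (auto simp: entry_mult_idem_mult matrix_unit.rep_eq)
qed

lemma matrix_unit_mult_0:
  assumes "w \<noteq> z"
  shows "matrix_unit x z * matrix_unit w y = 0"
proof -
  have "matrix_unit x z * matrix_unit w y = matrix_unit x z * idem w * matrix_unit w y"
    by (simp add: mult.assoc idem_mult_matrix_unit)
  then show ?thesis using assms by (simp add: matrix_unit_mult_idem)
qed

lemma scale_matrix_unit_eq_iff:
  "x \<le> y \<Longrightarrow> scale_fi r (matrix_unit x y) = scale_fi s (matrix_unit x y) \<longleftrightarrow> r = s"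
  by (metis (mono_tags, lifting) matrix_unit.rep_eq mult.right_neutral scale_fi.rep_eq)


section \<open>Products with the same Jordan structure\<close>

text \<open>The products whose identity map to the convolution algebra is a Jordan isomorphism. Working
  with a second product on \<open>FI(X,R)\<close> in place of an algebra \<open>A\<close> keeps both sides of the identities
  in one place and lets the opposite product be an instance of the same locale.\<close>

locale jordan_product =
  fixes jmult :: "('x::order, 'r::comm_ring_1) fi \<Rightarrow> ('x, 'r) fi \<Rightarrow> ('x, 'r) fi"  (infixl "\<odot>" 70)
  assumes jassoc: "(a \<odot> b) \<odot> c = a \<odot> (b \<odot> c)"
    and jadd_left: "(a + b) \<odot> c = a \<odot> c + b \<odot> c"
    and jadd_right: "a \<odot> (b + c) = a \<odot> b + a \<odot> c"
    and jscale_left: "scale_fi r a \<odot> b = scale_fi r (a \<odot> b)"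
    and jscale_right: "a \<odot> scale_fi r b = scale_fi r (a \<odot> b)"
    and jsquare: "a \<odot> a = a * a"
    and jtriple: "(a \<odot> b) \<odot> a = a * b * a"
begin

lemma jzero [simp]: "0 \<odot> a = 0" "a \<odot> 0 = 0"
  using jadd_left[of 0 0 a] jadd_right[of a 0 0] by simp_all

lemma jdiff_left: "(a - b) \<odot> c = a \<odot> c - b \<odot> c"
  using jadd_left[of "a - b" b c] by (simp add: algebra_simps)

lemma jdiff_right: "a \<odot> (b - c) = a \<odot> b - a \<odot> c"
  using jadd_right[of a "b - c" c] by (simp add: algebra_simps)

lemma jsquare_polarized: "a \<odot> b + b \<odot> a = a * b + b * a"
  using jsquare[of "a + b"] jsquare[of a] jsquare[of b]
  by (simp add: jadd_left jadd_right algebra_simps)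

lemma jtriple_polarized: "a \<odot> b \<odot> c + c \<odot> b \<odot> a = a * b * c + c * b * a"
  using jtriple[of "a + c" b] jtriple[of a b] jtriple[of c b]
  by (simp add: jadd_left jadd_right algebra_simps)

lemma jidem_self: "idem x \<odot> idem x = idem x"
  by (simp add: jsquare idem_mult_idem)

text \<open>The vanishing of \<open>e\<^sub>x \<odot> e\<^sub>y + e\<^sub>y \<odot> e\<^sub>x\<close> controls only the sum of the two products; multiplying
  by \<open>e\<^sub>x\<close> turns the second summand into the triple product \<open>e\<^sub>x \<odot> e\<^sub>y \<odot> e\<^sub>x = 0\<close>.\<close>

lemma jidem_orthogonal:
  assumes "x \<noteq> y"
  shows "idem x \<odot> idem y = 0"
proof -
  have *: "idem x \<odot> idem y + idem y \<odot> idem x = 0"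
    using assms by (simp add: jsquare_polarized idem_mult_idem)
  have "idem x \<odot> (idem x \<odot> idem y + idem y \<odot> idem x) = idem x \<odot> idem y"
    using jtriple[of "idem x" "idem y"] assms
    by (simp add: jadd_right jassoc[symmetric] jidem_self idem_mult_idem)
  then show ?thesis using * by simp
qed

text \<open>Corners are Peirce components for \<open>\<odot>\<close>. They are the bridge between the two products: their
  symmetrization is visible in the convolution, and they are multiplied through orthogonal
  idempotents in \<open>\<odot>\<close>.\<close>

definition corner :: "'x \<Rightarrow> ('x, 'r) fi \<Rightarrow> 'x \<Rightarrow> ('x, 'r) fi" where
  "corner x f y = idem x \<odot> f \<odot> idem y"

lemma corner_self: "corner x f x = idem x * f * idem x"
  by (simp add: corner_def jtriple)

lemma corner_add_swap: "corner x f y + corner y f x = idem x * f * idem y + idem y * f * idem x"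
  by (simp add: corner_def jtriple_polarized)

lemma corner_linear:
  "corner x (f - g) y = corner x f y - corner x g y"
  "corner x (f + g) y = corner x f y + corner x g y"
  "corner x (scale_fi r f) y = scale_fi r (corner x f y)"
  "corner x 0 y = 0"
  by (simp_all add: corner_def jadd_left jadd_right jdiff_left jdiff_right jscale_left jscale_right)

lemma corner_corner:
  "corner u (corner x f y) v = (if u = x \<and> v = y then corner x f y else 0)"
proof -
  have "corner u (corner x f y) v = (idem u \<odot> idem x) \<odot> f \<odot> (idem y \<odot> idem v)"
    by (simp add: corner_def jassoc)
  then show ?thesis
    by (auto simp: jidem_orthogonal jidem_self) (auto simp: corner_def)
qed

text \<open>Symmetrized corners are the same for both products, and the entries of an element can be read
  off from the latter. No sum of idempotents is involved, so \<open>X\<close> may be infinite.\<close>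

lemma eq_if_corners_eq:
  assumes "\<And>x y. corner x f y = corner x g y"
  shows "f = g"
proof (rule fi_eqI)
  fix x y
  have 0: "corner x (f - g) y = 0" for x y
    using assms by (simp add: corner_linear)
  have "entry (f - g) x y = 0"
  proof (cases "x = y")
    case True
    then show ?thesis
      using 0[of x x] by (simp add: corner_self) (metis entry_idem_mult entry_mult_idem zero_fi.rep_eq)
  next
    case False
    have "idem x * (f - g) * idem y + idem y * (f - g) * idem x = 0"
      by (simp flip: corner_add_swap add: 0)
    then have "entry (idem x * (f - g) * idem y + idem y * (f - g) * idem x) x y = 0"
      by (simp add: entry_simps)
    then show ?thesis using False by (simp add: entry_simps entry_mult_idem entry_idem_mult)
  qed
  then show "entry f x y = entry g x y" by (simp add: entry_simps)
qed

text \<open>The idempotent of \<open>R\<close> that measures which part of the matrix unit at \<open>(x, y)\<close> behaves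
  homomorphically under \<open>\<odot>\<close>.\<close>

definition coef :: "'x \<Rightarrow> 'x \<Rightarrow> 'r" where
  "coef x y = entry (corner x (matrix_unit x y) y) x y"

lemma coef_self: "coef x x = 1"
  by (simp add: coef_def corner_self matrix_unit_self idem_mult_idem idem.rep_eq)

text \<open>The corner of \<open>f\<close> at \<open>(x, y)\<close> is also the corner of its symmetrized corner, which is a
  multiple of the matrix unit; so only the matrix unit has to be understood, and its corner is again a multiple of itself.\<close>

lemma corner_eq:
  assumes "x \<le> y"
  shows "corner x f y = scale_fi (coef x y * entry f x y) (matrix_unit x y)"
proof (cases "x = y")
  case True
  then show ?thesis by (simp add: corner_self coef_self idem_mult_mult_idem)
next
  case False
  with assms have ne: "x \<noteq> y" and gt: "\<not> y \<le> x" by auto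
  have sum: "corner x g y + corner y g x = scale_fi (entry g x y) (matrix_unit x y)" for g
    using gt by (simp add: corner_add_swap idem_mult_mult_idem entry_outside)
  have "corner x f y = corner x (corner x f y + corner y f x) y"
    using ne by (simp add: corner_linear corner_corner)
  also have "\<dots> = scale_fi (entry f x y) (corner x (matrix_unit x y) y)"
    by (simp add: sum corner_linear)
  also have "corner x (matrix_unit x y) y = scale_fi (coef x y) (matrix_unit x y)"
    using sum[of "corner x (matrix_unit x y) y"] ne by (simp add: corner_corner coef_def)
  finally show ?thesis by (simp add: mult.commute)
qed

lemma coef_idempotent:
  assumes "x \<le> y"
  shows "coef x y * coef x y = coef x y"
proof -
  have "scale_fi (coef x y) (matrix_unit x y) = corner x (matrix_unit x y) y"
    using assms by (simp add: corner_eq matrix_unit.rep_eq)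
  also have "\<dots> = corner x (corner x (matrix_unit x y) y) y"
    by (simp add: corner_corner)
  also have "\<dots> = scale_fi (coef x y * coef x y) (matrix_unit x y)"
    using assms by (simp add: corner_eq matrix_unit.rep_eq entry_simps)
  finally show ?thesis using assms by (simp add: scale_matrix_unit_eq_iff)
qed

lemma corner_swap_eq:
  assumes "x < y"
  shows "corner y f x = scale_fi ((1 - coef x y) * entry f x y) (matrix_unit x y)"
proof -
  have "corner y f x = scale_fi (entry f x y) (matrix_unit x y) - corner x f y"
    using assms corner_add_swap[of x f y]
    by (simp add: idem_mult_mult_idem entry_outside less_le_not_le eq_diff_eq add.commute)
  then show ?thesis
    using assms by (simp add: corner_eq fi.scale_left_diff_distrib left_diff_distrib)
qed

lemma corner_incomparable:
  assumes "\<not> x \<le> y" "\<not> y \<le> x"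
  shows "corner x f y = 0"
proof -
  have ne: "x \<noteq> y" using assms by auto
  have "corner x f y + corner y f x = 0"
    using assms by (simp add: corner_add_swap idem_mult_mult_idem entry_outside)
  then have "corner x (corner x f y + corner y f x) y = 0"
    by (simp add: corner_linear)
  then show ?thesis using ne by (simp add: corner_linear corner_corner)
qed

text \<open>The product \<open>a \<odot> b\<close> of the homomorphic parts of two composable matrix units lies in the
  corner at \<open>(x, y)\<close>, where \<open>coef x y\<close> acts as the identity. It equals \<open>a * b\<close> because both products
  in the reverse order vanish.\<close>

lemma coef_chain_le:
  assumes "x < z" "z < y"
  shows "coef x y * (coef x z * coef z y) = coef x z * coef z y"
proof -
  define a b where "a = corner x (matrix_unit x z) z" and "b = corner z (matrix_unit z y) y"
  have xy: "x < y" using assms by simp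
  have a: "a = scale_fi (coef x z) (matrix_unit x z)" and b: "b = scale_fi (coef z y) (matrix_unit z y)"
    using assms by (simp_all add: a_def b_def corner_eq matrix_unit.rep_eq less_imp_le)
  have "b \<odot> a = idem z \<odot> matrix_unit z y \<odot> (idem y \<odot> idem x) \<odot> matrix_unit x z \<odot> idem z"
    by (simp add: a_def b_def corner_def jassoc)
  then have "b \<odot> a = 0" using xy by (simp add: jidem_orthogonal)
  then have ab: "a \<odot> b = scale_fi (coef x z * coef z y) (matrix_unit x y)"
    using jsquare_polarized[of a b] assms xy
    by (simp add: a b fi.scale_mult_left fi.scale_mult_right matrix_unit_mult matrix_unit_mult_0
        less_imp_le mult.commute)
  have "corner x (a \<odot> b) y = (idem x \<odot> idem x) \<odot> matrix_unit x z \<odot> idem z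
      \<odot> (idem z \<odot> matrix_unit z y \<odot> (idem y \<odot> idem y))"
    by (simp add: a_def b_def corner_def jassoc)
  also have "\<dots> = a \<odot> b"
    by (simp add: jidem_self a_def b_def corner_def jassoc)
  finally show ?thesis
    using xy by (simp add: ab corner_eq matrix_unit.rep_eq entry_simps less_imp_le scale_matrix_unit_eq_iff)
qed

text \<open>The homomorphic part of one matrix unit and the antihomomorphic part of the next lie in
  corners that do not meet for \<open>\<odot>\<close> in either order, whereas the convolution product of the two
  parts is a multiple of a matrix unit.\<close>

lemma coef_chain_mixed:
  assumes "x < z" "z < y"
  shows "coef x z * (1 - coef z y) = 0"
proof -
  define a b where "a = corner x (matrix_unit x z) z" and "b = corner y (matrix_unit z y) z"
  have xy: "x < y" using assms by simp
  have a: "a = scale_fi (coef x z) (matrix_unit x z)"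
    and b: "b = scale_fi (1 - coef z y) (matrix_unit z y)"
    using assms by (simp_all add: a_def b_def corner_eq corner_swap_eq matrix_unit.rep_eq less_imp_le)
  have "a \<odot> b = idem x \<odot> matrix_unit x z \<odot> (idem z \<odot> idem y) \<odot> matrix_unit z y \<odot> idem z"
    "b \<odot> a = idem y \<odot> matrix_unit z y \<odot> (idem z \<odot> idem x) \<odot> matrix_unit x z \<odot> idem z"
    by (simp_all add: a_def b_def corner_def jassoc)
  then have "a \<odot> b + b \<odot> a = 0" using assms by (simp add: jidem_orthogonal)
  then have "scale_fi (coef x z * (1 - coef z y)) (matrix_unit x y) = scale_fi 0 (matrix_unit x y)"
    using assms xy
    by (simp add: jsquare_polarized a b fi.scale_mult_left fi.scale_mult_right matrix_unit_mult
        matrix_unit_mult_0 less_imp_le mult.commute)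
  then show ?thesis using xy by (simp only: scale_matrix_unit_eq_iff less_imp_le)
qed

text \<open>On strict elements this is the function \<open>g\<close> of the theorem; diagonal elements are fixed because
  \<open>coef x x = 1\<close>.\<close>

definition hom_part :: "('x, 'r) fi \<Rightarrow> ('x, 'r) fi" where
  "hom_part f = Abs_fi (\<lambda>x y. coef x y * entry f x y)"

lemma entry_hom_part: "entry (hom_part f) x y = coef x y * entry f x y"
proof -
  have "finitary_fun (\<lambda>x y. coef x y * entry f x y)"
    by (rule finitary_fun_subset[OF finitary_fun_entry[of f] finitary_fun_entry[of f]])
      (auto simp: incidence_fun_def entry_outside)
  then show ?thesis by (simp add: hom_part_def Abs_fi_inverse)
qed

lemma hom_part_add: "hom_part (f + g) = hom_part f + hom_part g"
  by (rule fi_eqI) (simp add: entry_hom_part entry_simps distrib_left)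

lemma hom_part_scale: "hom_part (scale_fi r f) = scale_fi r (hom_part f)"
  by (rule fi_eqI) (simp add: entry_hom_part entry_simps mult.left_commute)

lemma hom_part_hom_part: "hom_part (hom_part f) = hom_part f"
proof (rule fi_eqI)
  fix x y
  show "entry (hom_part (hom_part f)) x y = entry (hom_part f) x y"
    by (cases "x \<le> y") (simp_all add: entry_hom_part entry_outside coef_idempotent flip: mult.assoc)
qed

lemma hom_part_D: "f \<in> fi_D \<Longrightarrow> hom_part f = f"
proof (rule fi_eqI)
  fix x y
  assume "f \<in> fi_D"
  then show "entry (hom_part f) x y = entry f x y"
    by (cases "x = y") (simp_all add: entry_hom_part coef_self fi_D_def)
qed

lemma hom_part_FZ: "f \<in> fi_FZ \<Longrightarrow> hom_part f \<in> fi_FZ"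
  by (simp add: fi_FZ_def entry_hom_part)

text \<open>For incomparable \<open>x\<close> and \<open>y\<close> both sides are zero. For \<open>y < x\<close> the left side is the
  antihomomorphic corner, which \<open>hom_part\<close> kills since \<open>(1 - c) c = 0\<close>.\<close>

lemma corner_hom_part: "corner x (hom_part f) y = idem x * hom_part f * idem y"
proof -
  consider "x \<le> y" | "y < x" | "\<not> x \<le> y" "\<not> y \<le> x" by fastforce
  then show ?thesis
  proof cases
    case 1
    then show ?thesis
      by (simp add: corner_eq idem_mult_mult_idem entry_hom_part coef_idempotent flip: mult.assoc)
  next
    case 2
    then have "(1 - coef y x) * coef y x = 0"
      by (simp add: left_diff_distrib coef_idempotent)
    with 2 show ?thesis
      by (simp add: corner_swap_eq idem_mult_mult_idem entry_hom_part entry_outside less_le_not_le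
          flip: mult.assoc)
  next
    case 3
    then show ?thesis by (simp add: corner_incomparable idem_mult_mult_idem entry_outside)
  qed
qed

lemma hom_part_idem_mult: "hom_part (idem x * hom_part f) = idem x * hom_part f"
proof -
  have "hom_part (idem x * g) = idem x * hom_part g" for g
    by (rule fi_eqI) (simp add: entry_hom_part entry_idem_mult)
  then show ?thesis by (simp add: hom_part_hom_part)
qed

lemma hom_part_mult_idem: "hom_part (hom_part f * idem x) = hom_part f * idem x"
proof -
  have "hom_part (g * idem x) = hom_part g * idem x" for g
    by (rule fi_eqI) (simp add: entry_hom_part entry_mult_idem)
  then show ?thesis by (simp add: hom_part_hom_part)
qed

text \<open>A row of a homomorphic part is again a homomorphic part, so the corners of both sides are
  entries of convolution products and can be compared there.\<close>

lemma jidem_hom_part: "idem x \<odot> hom_part f = idem x * hom_part f"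
proof (rule eq_if_corners_eq)
  fix u v
  have "corner u (idem x \<odot> hom_part f) v = (idem u \<odot> idem x) \<odot> hom_part f \<odot> idem v"
    by (simp add: corner_def jassoc)
  also have "\<dots> = (if u = x then corner x (hom_part f) v else 0)"
    by (simp add: jidem_orthogonal jidem_self corner_def)
  also have "\<dots> = (idem u * idem x) * hom_part f * idem v"
    by (simp add: corner_hom_part idem_mult_idem)
  also have "\<dots> = corner u (idem x * hom_part f) v"
    using corner_hom_part[of u "idem x * hom_part f" v] by (simp add: hom_part_idem_mult mult.assoc)
  finally show "corner u (idem x \<odot> hom_part f) v = corner u (idem x * hom_part f) v" .
qed

lemma hom_part_jidem: "hom_part f \<odot> idem x = hom_part f * idem x"
proof (rule eq_if_corners_eq)
  fix u v
  have "corner u (hom_part f \<odot> idem x) v = idem u \<odot> hom_part f \<odot> (idem x \<odot> idem v)"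
    by (simp add: corner_def jassoc)
  also have "\<dots> = (if v = x then corner u (hom_part f) x else 0)"
    by (simp add: jidem_orthogonal jidem_self corner_def)
  also have "\<dots> = idem u * hom_part f * (idem x * idem v)"
    by (simp add: corner_hom_part idem_mult_idem)
  also have "\<dots> = corner u (hom_part f * idem x) v"
    using corner_hom_part[of u "hom_part f * idem x" v] by (simp add: hom_part_mult_idem mult.assoc)
  finally show "corner u (hom_part f \<odot> idem x) v = corner u (hom_part f * idem x) v" .
qed

text \<open>With \<open>r = e\<^sub>x \<odot> f\<close> and \<open>q = g \<odot> e\<^sub>y\<close> the corner is \<open>r \<odot> q\<close>, and \<open>q \<odot> r\<close> contains the factor
  \<open>e\<^sub>y \<odot> e\<^sub>x = 0\<close>. So \<open>r \<odot> q\<close> equals the symmetrized product, which is the same for the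
  convolution. The sum over intermediate points is never expanded.\<close>

lemma corner_jmult:
  assumes "x \<noteq> y"
  shows "corner x (f \<odot> g) y
    = (idem x \<odot> f) * (g \<odot> idem y) + (g \<odot> idem y) * (idem x \<odot> f)"
proof -
  have "(g \<odot> idem y) \<odot> (idem x \<odot> f) = g \<odot> (idem y \<odot> idem x) \<odot> f"
    by (simp add: jassoc)
  then have "(g \<odot> idem y) \<odot> (idem x \<odot> f) = 0"
    using assms by (simp add: jidem_orthogonal)
  then show ?thesis
    using jsquare_polarized[of "idem x \<odot> f" "g \<odot> idem y"] by (simp add: corner_def jassoc)
qed

text \<open>On the diagonal \<open>q \<odot> r\<close> does not vanish, but its corner is a product of two diagonal corners,
  that is, of two diagonal entries.\<close>

lemma corner_jmult_self:
  "corner x (f \<odot> g) x + scale_fi (entry g x x * entry f x x) (idem x)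
    = idem x * ((idem x \<odot> f) * (g \<odot> idem x) + (g \<odot> idem x) * (idem x \<odot> f)) * idem x"
proof -
  have "corner x ((g \<odot> idem x) \<odot> (idem x \<odot> f)) x = corner x g x \<odot> corner x f x"
    by (simp add: corner_def jassoc)
  also have "\<dots> = scale_fi (entry g x x * entry f x x) (idem x)"
    by (simp add: corner_self idem_mult_mult_idem matrix_unit_self jscale_left jscale_right jidem_self
        mult.commute)
  finally have "corner x ((g \<odot> idem x) \<odot> (idem x \<odot> f)) x
    = scale_fi (entry g x x * entry f x x) (idem x)" .
  moreover have "corner x ((idem x \<odot> f) \<odot> (g \<odot> idem x)) x
      = (idem x \<odot> idem x) \<odot> f \<odot> g \<odot> (idem x \<odot> idem x)"
    by (simp add: corner_def jassoc)
  then have "corner x ((idem x \<odot> f) \<odot> (g \<odot> idem x)) x = corner x (f \<odot> g) x"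
    by (simp add: jidem_self corner_def jassoc)
  ultimately have "corner x (f \<odot> g) x + scale_fi (entry g x x * entry f x x) (idem x)
    = corner x ((idem x \<odot> f) \<odot> (g \<odot> idem x) + (g \<odot> idem x) \<odot> (idem x \<odot> f)) x"
    by (simp add: corner_linear)
  then show ?thesis by (simp add: jsquare_polarized corner_self)
qed

text \<open>The strictness of \<open>f\<close> removes the extra term of the diagonal corners.\<close>

lemma jmult_eq_0:
  assumes f: "f \<in> fi_FZ"
    and fg: "\<And>x y. (idem x \<odot> f) * (g \<odot> idem y) = 0"
    and gf: "\<And>x y. (g \<odot> idem y) * (idem x \<odot> f) = 0"
  shows "f \<odot> g = 0"
proof (rule eq_if_corners_eq)
  fix x y
  show "corner x (f \<odot> g) y = corner x 0 y"
  proof (cases "x = y")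
    case True
    then show ?thesis
      using corner_jmult_self[of x f g] f by (simp add: fg gf fi_FZ_def corner_linear)
  next
    case False
    then show ?thesis by (simp add: corner_jmult fg gf corner_linear)
  qed
qed

end


section \<open>The opposite product\<close>

context jordan_product
begin

lemma jordan_product_opposite: "jordan_product (\<lambda>f g. g \<odot> f)"
proof
  show "a \<odot> (b \<odot> a) = a * b * a" for a b
    by (simp add: jtriple flip: jassoc)
qed (simp_all add: jassoc jadd_left jadd_right jscale_left jscale_right jsquare)

interpretation opp: jordan_product "\<lambda>f g. g \<odot> f"
  by (rule jordan_product_opposite)

lemma opp_corner: "opp.corner x f y = corner y f x"
  by (simp add: opp.corner_def corner_def jassoc)

lemma opp_coef:
  assumes "x < y"
  shows "opp.coef x y = 1 - coef x y"
  using assms by (simp add: opp.coef_def opp_corner corner_swap_eq entry_simps matrix_unit.rep_eq less_imp_le)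

lemma coef_chain_mixed':
  assumes "x < z" "z < y"
  shows "(1 - coef x z) * coef z y = 0"
  using opp.coef_chain_mixed[OF assms] assms by (simp add: opp_coef)

text \<open>For \<open>x < z < y\<close> the two mixed identities give \<open>c(x,z) = c(z,y)\<close>. Call this value \<open>c\<close>. Then
  \<open>c \<le> c(x,y)\<close> as idempotents by \<open>coef_chain_le\<close>, and \<open>1 - c \<le> 1 - c(x,y)\<close> by the same lemma for
  the opposite product.\<close>

lemma coef_chain:
  assumes "x \<le> z" "z \<le> y"
  shows "coef x z * coef z y = coef x y"
proof (cases "x = z \<or> z = y")
  case True
  then show ?thesis by (auto simp: coef_self)
next
  case False
  with assms have xz: "x < z" and zy: "z < y" by auto
  define c where "c = coef x z"
  have c: "coef z y = c" 
    using coef_chain_mixed[OF xz zy] coef_chain_mixed'[OF xz zy]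
    by (simp add: c_def algebra_simps)
  have cc: "c * c = c" using xz by (simp add: c_def coef_idempotent less_imp_le)
  have 1: "coef x y * c = c"
    using coef_chain_le[OF xz zy] c cc by (simp add: c_def)
  have "(1 - coef x y) * ((1 - c) * (1 - c)) = (1 - c) * (1 - c)"
    using opp.coef_chain_le[OF xz zy] xz zy c by (simp add: opp_coef c_def)
  moreover have "(1 - c) * (1 - c) = 1 - c" using cc by (simp add: algebra_simps)
  ultimately have "(1 - coef x y) * (1 - c) = 1 - c" by simp
  with 1 have "coef x y = c" by (simp add: algebra_simps)
  then show ?thesis using c cc by (simp add: c_def)
qed

lemma hom_part_mult: "hom_part (f * g) = hom_part f * hom_part g"
proof (rule fi_eqI)
  fix x y
  show "entry (hom_part (f * g)) x y = entry (hom_part f * hom_part g) x y"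
  proof (cases "x \<le> y")
    case False
    then show ?thesis by (simp add: entry_outside)
  next
    case True
    \<comment> \<open>One finite index set serves both products, since \<open>hom_part f\<close> vanishes wherever \<open>f\<close> does.\<close>
    let ?S = "hull_set (entry f) x y"
    have S: "finite ?S" by (rule finite_hull_set[OF finitary_fun_entry True])
    have inS: "z \<in> ?S" if "x \<le> z" "z \<le> y" "entry f x z \<noteq> 0" for z
      using that hull_set_mem(2)[of x z x y "entry f"]
      by (cases "x = z") (auto simp: hull_set_def)
    have "entry (f * g) x y = (\<Sum>z\<in>?S. entry f x z * entry g z y)"
      unfolding times_fi.rep_eq
      by (rule convolution_eq_sum[OF incidence_fun_entry incidence_fun_entry S]) (rule inS)
    moreover have "entry (hom_part f * hom_part g) x y
        = (\<Sum>z\<in>?S. entry (hom_part f) x z * entry (hom_part g) z y)"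
      unfolding times_fi.rep_eq
      by (rule convolution_eq_sum[OF incidence_fun_entry incidence_fun_entry S])
        (rule inS, auto simp: entry_hom_part)
    moreover have "coef x y * (entry f x z * entry g z y)
        = entry (hom_part f) x z * entry (hom_part g) z y" if "z \<in> ?S" for z
      using coef_chain[of x z y] hull_set_le[OF True that]
      by (simp add: entry_hom_part mult_ac)
    ultimately show ?thesis by (simp add: entry_hom_part sum_distrib_left)
  qed
qed

text \<open>Rows and columns of homomorphic parts are the same for both products, so the corner formulas
  yield corners of the convolution product.\<close>

lemma hom_part_jmult: "hom_part f \<odot> hom_part g = hom_part (f * g)"
proof (rule eq_if_corners_eq)
  fix x y
  let ?f = "hom_part f" and ?g = "hom_part g"
  have fg: "corner x (hom_part (f * g)) y = idem x * ?f * (?g * idem y)" for x y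
    by (simp add: corner_hom_part) (simp add: hom_part_mult mult.assoc)
  show "corner x (?f \<odot> ?g) y = corner x (hom_part (f * g)) y"
  proof (cases "x = y")
    case False
    have "(?g * idem y) * (idem x * ?f) = ?g * (idem y * idem x) * ?f"
      by (simp add: mult.assoc)
    then show ?thesis
      using False by (simp add: corner_jmult jidem_hom_part hom_part_jidem fg idem_mult_idem)
  next
    case True
    have "idem x * ((?g * idem x) * (idem x * ?f)) * idem x
        = (idem x * ?g * idem x) * (idem x * ?f * idem x)"
      by (simp add: mult.assoc)
    also have "\<dots> = scale_fi (entry ?g x x * entry ?f x x) (idem x)"
      by (simp add: idem_mult_mult_idem matrix_unit_self fi.scale_mult_left fi.scale_mult_right
          idem_mult_idem mult.commute)
    finally have gf: "idem x * ((?g * idem x) * (idem x * ?f)) * idem x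
        = scale_fi (entry ?g x x * entry ?f x x) (idem x)" .
    have "idem x * ((idem x * ?f) * (?g * idem x)) * idem x
        = (idem x * idem x) * ?f * ?g * (idem x * idem x)"
      by (simp add: mult.assoc)
    then have "idem x * ((idem x * ?f) * (?g * idem x)) * idem x = idem x * ?f * (?g * idem x)"
      by (simp add: idem_mult_idem mult.assoc)
    with gf show ?thesis
      using corner_jmult_self[of x ?f ?g] True
      by (simp add: jidem_hom_part hom_part_jidem fg distrib_left distrib_right)
  qed
qed

end

text \<open>Interpreting the opposite product again makes its copies of the results just proved
  available.\<close>

context jordan_product
begin

interpretation opp: jordan_product "\<lambda>f g. g \<odot> f"
  by (rule jordan_product_opposite)

text \<open>The homomorphic part for the opposite product; on strict elements this is the function \<open>h\<close>
  of the theorem.\<close>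

definition anti_part :: "('x, 'r) fi \<Rightarrow> ('x, 'r) fi" where
  "anti_part f = opp.hom_part f"

lemma entry_anti_part:
  "entry (anti_part f) x y = (if x = y then entry f x y else (1 - coef x y) * entry f x y)"
  using opp_coef[of x y]
  by (cases "x \<le> y") (auto simp: anti_part_def opp.entry_hom_part opp.coef_self entry_outside order_less_le)

text \<open>Each entry of these products, at \<open>(u, v)\<close> say, is a single term through \<open>z\<close>. It can be nonzero
  only if \<open>u < z < v\<close>, because \<open>f\<close> and \<open>g\<close> are strict, so the mixed identities for \<open>coef\<close> apply.\<close>

lemma hom_part_idem_anti_part:
  assumes "f \<in> fi_FZ" "g \<in> fi_FZ"
  shows "hom_part f * idem z * anti_part g = 0" "anti_part f * idem z * hom_part g = 0"
proof -
  have *: "entry f u z * entry g z v \<noteq> 0 \<Longrightarrow> u < z \<and> z < v" for u v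
    using assms entry_outside[of u z f] entry_outside[of z v g]
    by (metis (mono_tags, lifting) fi_FZ_def mem_Collect_eq mult_zero_left mult_zero_right order_less_le)
  have flip: "entry (anti_part h) u v = (1 - coef u v) * entry h u v" if "h \<in> fi_FZ" for h u v
    using that by (simp add: entry_anti_part fi_FZ_def)
  show "hom_part f * idem z * anti_part g = 0"
  proof (rule fi_eqI)
    fix u v
    have "coef u z * (1 - coef z v) * (entry f u z * entry g z v) = 0"
      using *[of u v] coef_chain_mixed[of u z v] by fastforce
    then show "entry (hom_part f * idem z * anti_part g) u v = entry 0 u v"
      unfolding entry_mult_idem_mult entry_hom_part flip[OF assms(2)] zero_fi.rep_eq
      by (simp only: mult_ac)
  qed
  show "anti_part f * idem z * hom_part g = 0"
  proof (rule fi_eqI)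
    fix u v
    have "(1 - coef u z) * coef z v * (entry f u z * entry g z v) = 0"
      using *[of u v] coef_chain_mixed'[of u z v] by fastforce
    then show "entry (anti_part f * idem z * hom_part g) u v = entry 0 u v"
      unfolding entry_mult_idem_mult entry_hom_part flip[OF assms(1)] zero_fi.rep_eq
      by (simp only: mult_ac)
  qed
qed

text \<open>Multiplication by idempotents is the convolution on homomorphic parts and the reversed
  convolution on antihomomorphic parts. This places an idempotent between the two mixed factors.\<close>

lemma hom_part_jmult_anti_part:
  assumes "f \<in> fi_FZ" "g \<in> fi_FZ"
  shows "hom_part f \<odot> anti_part g = 0"
proof (rule jmult_eq_0)
  show "hom_part f \<in> fi_FZ" using assms(1) by (rule hom_part_FZ)
  have l: "idem x \<odot> hom_part f = idem x * hom_part f" for x by (rule jidem_hom_part)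
  have r: "anti_part g \<odot> idem y = idem y * anti_part g" for y
    unfolding anti_part_def by (rule opp.jidem_hom_part)
  show "(idem x \<odot> hom_part f) * (anti_part g \<odot> idem y) = 0" for x y
    using hom_part_idem_anti_part(1)[OF assms, of y] by (simp add: l r mult.assoc)
  show "(anti_part g \<odot> idem y) * (idem x \<odot> hom_part f) = 0" for x y
    using hom_part_idem_anti_part(2)[OF assms(2,1), of x] by (simp add: l r mult.assoc)
qed

lemma anti_part_jmult_hom_part:
  assumes "f \<in> fi_FZ" "g \<in> fi_FZ"
  shows "anti_part f \<odot> hom_part g = 0"
proof (rule jmult_eq_0)
  show "anti_part f \<in> fi_FZ" using assms(1) by (simp add: anti_part_def opp.hom_part_FZ)
  have l: "idem x \<odot> anti_part f = anti_part f * idem x" for x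
    unfolding anti_part_def by (rule opp.hom_part_jidem)
  have r: "hom_part g \<odot> idem y = hom_part g * idem y" for y by (rule hom_part_jidem)
  show "(idem x \<odot> anti_part f) * (hom_part g \<odot> idem y) = 0" for x y
    using hom_part_idem_anti_part(2)[OF assms, of x] by (simp add: l r flip: mult.assoc)
  show "(hom_part g \<odot> idem y) * (idem x \<odot> anti_part f) = 0" for x y
    using hom_part_idem_anti_part(1)[OF assms(2,1), of y] by (simp add: l r flip: mult.assoc)
qed

lemma anti_part_jmult: "anti_part g \<odot> anti_part f = anti_part (f * g)"
  unfolding anti_part_def by (rule opp.hom_part_jmult)

lemma anti_part_add: "anti_part (f + g) = anti_part f + anti_part g"
  unfolding anti_part_def by (rule opp.hom_part_add)

lemma anti_part_scale: "anti_part (scale_fi r f) = scale_fi r (anti_part f)"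
  unfolding anti_part_def by (rule opp.hom_part_scale)

lemma anti_part_D: "f \<in> fi_D \<Longrightarrow> anti_part f = f"
  unfolding anti_part_def by (rule opp.hom_part_D)

lemma anti_part_FZ: "f \<in> fi_FZ \<Longrightarrow> anti_part f \<in> fi_FZ"
  unfolding anti_part_def by (rule opp.hom_part_FZ)

lemma hom_part_add_anti_part: "f \<in> fi_FZ \<Longrightarrow> hom_part f + anti_part f = f"
  by (rule fi_eqI) (auto simp: entry_hom_part entry_anti_part entry_simps fi_FZ_def algebra_simps)

text \<open>The entries of the corners are the values in the definition of \<open>g\<close> and \<open>h\<close>.\<close>

lemma entry_corner:
  assumes "x \<le> y"
  shows "entry (corner x f y) x y = entry (hom_part f) x y"
    and "entry (corner y f x) x y = entry (anti_part f) x y"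
proof -
  show "entry (corner x f y) x y = entry (hom_part f) x y"
    using assms by (simp add: corner_eq entry_hom_part entry_simps matrix_unit.rep_eq)
  show "entry (corner y f x) x y = entry (anti_part f) x y"
  proof (cases "x = y")
    case True
    then show ?thesis by (simp add: corner_self entry_anti_part entry_mult_idem entry_idem_mult)
  next
    case False
    with assms show ?thesis
      by (simp add: corner_swap_eq entry_anti_part entry_simps matrix_unit.rep_eq)
  qed
qed

end


section \<open>Diagonal and strict elements\<close>

lemma entry_mult_nonzero:
  assumes "entry (f * g) x y \<noteq> 0"
  obtains z where "x \<le> z" "z \<le> y" "entry f x z \<noteq> 0" "entry g z y \<noteq> 0"
  using assms unfolding times_fi.rep_eq by (rule convolution_nonzero)

lemma fi_D_subalgebra: "is_subalgebra scale_fi (fi_D :: ('x::order, 'r::comm_ring_1) fi set)"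
proof -
  have "f * g \<in> fi_D" if "f \<in> fi_D" "g \<in> fi_D" for f g :: "('x, 'r) fi"
    unfolding fi_D_def
  proof (intro CollectI allI impI)
    fix x y :: 'x assume "x \<noteq> y"
    then show "entry (f * g) x y = 0"
      using that entry_mult_nonzero[of f g x y] unfolding fi_D_def mem_Collect_eq by metis
  qed
  then show ?thesis
    by (auto simp: is_subalgebra_def fi.subspace_def fi_D_def entry_simps)
qed

lemma fi_FZ_ideal: "is_ideal scale_fi (fi_FZ :: ('x::order, 'r::comm_ring_1) fi set)"
proof -
  have "f * g \<in> fi_FZ" "g * f \<in> fi_FZ" if "f \<in> fi_FZ" for f g :: "('x, 'r) fi"
  proof -
    have "entry (f * g) x x = 0" "entry (g * f) x x = 0" for x
      using that entry_mult_nonzero[of f g x x] entry_mult_nonzero[of g f x x]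
      unfolding fi_FZ_def mem_Collect_eq by (metis order_antisym)+
    then show "f * g \<in> fi_FZ" "g * f \<in> fi_FZ" by (simp_all add: fi_FZ_def)
  qed
  then show ?thesis
    by (auto simp: is_ideal_def fi.subspace_def fi_FZ_def entry_simps)
qed

lemma diag_part_add_strict_part: "diag_part f + strict_part f = f"
  by (simp add: strict_part_def)

lemma fi_D_FZ_decomposition: "direct_sum_decomposition fi_D fi_FZ"
  unfolding direct_sum_decomposition_def
proof (intro conjI allI)
  have "f = 0" if "f \<in> fi_D" "f \<in> fi_FZ" for f :: "('a, 'b) fi"
  proof (rule fi_eqI)
    fix x y
    show "entry f x y = entry 0 x y"
      using that by (cases "x = y") (simp_all add: fi_D_def fi_FZ_def entry_simps)
  qed
  then show "fi_D \<inter> fi_FZ = {0 :: ('a, 'b) fi}"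
    by (auto simp: fi_D_def fi_FZ_def entry_simps)
next
  fix f :: "('a, 'b) fi"
  show "\<exists>d\<in>fi_D. \<exists>s\<in>fi_FZ. f = d + s"
    using diag_part_in_D strict_part_in_FZ diag_part_add_strict_part by metis
qed


section \<open>Jordan isomorphisms are near-sums\<close>

theorem theorem2p13:
  fixes scaleA :: "'r::comm_ring_1 \<Rightarrow> 'a::ring \<Rightarrow> 'a"
    and \<phi> :: "('x::order, 'r) fi \<Rightarrow> 'a"
  assumes "two_torsionfree TYPE('r)"
    and "assoc_algebra scaleA"
    and "jordan_iso scale_fi scaleA \<phi>"
  shows "(\<forall>f\<in>fi_FZ. (\<exists>g\<in>fi_FZ. entry g = psi_fun \<phi> f) \<and> (\<exists>h\<in>fi_FZ. entry h = theta_fun \<phi> f)) \<and>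
    is_near_sum scale_fi scaleA fi_D fi_FZ (psi_tilde \<phi>) (theta_tilde \<phi>) \<phi>"
proof -
  interpret A: assoc_algebra scaleA by fact
  have hom: "module_hom scale_fi scaleA \<phi>"
    and square: "\<phi> (a * a) = \<phi> a * \<phi> a"
    and triple: "\<phi> (a * b * a) = \<phi> a * \<phi> b * \<phi> a"
    and bij: "bij \<phi>" for a b
    using assms(3) by (auto simp: jordan_iso_def jordan_hom_def)
  interpret \<phi>: module_hom scale_fi scaleA \<phi> by (rule hom)
  define jm where "jm a b = inv \<phi> (\<phi> a * \<phi> b)" for a b
  have \<phi>_jm: "\<phi> (jm a b) = \<phi> a * \<phi> b" for a b
    unfolding jm_def using bij by (simp add: bij_is_surj surj_f_inv_f)
  have inv_\<phi>: "inv \<phi> (\<phi> a) = a" for a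
    using bij by (simp add: bij_is_inj)
  interpret J: jordan_product jm
    by (unfold_locales; rule injD[OF bij_is_inj[OF bij]])
      (simp_all add: \<phi>_jm \<phi>.add \<phi>.scale square triple[unfolded mult.assoc] mult.assoc distrib_left distrib_right
        A.scale_mult_left A.scale_mult_right)
  have corner: "inv \<phi> (\<phi> (idem x) * \<phi> f * \<phi> (idem y)) = J.corner x f y" for x f y
    by (simp add: J.corner_def inv_\<phi> flip: \<phi>_jm)
  have psi_fun: "psi_fun \<phi> f = entry (J.hom_part f)" for f
    by (intro ext) (simp add: psi_fun_def corner J.entry_corner entry_outside)
  have theta_fun: "theta_fun \<phi> f = entry (J.anti_part f)" for f
    by (intro ext) (simp add: theta_fun_def corner J.entry_corner entry_outside)
  have psi: "psi_tilde \<phi> f = \<phi> (J.hom_part f)" for f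
  proof -
    have "psi_tilde \<phi> f = \<phi> (J.hom_part (diag_part f) + J.hom_part (strict_part f))"
      by (simp add: psi_tilde_def psi_fun entry_inverse \<phi>.add J.hom_part_D diag_part_in_D)
    then show ?thesis by (simp flip: J.hom_part_add add: diag_part_add_strict_part)
  qed
  have theta: "theta_tilde \<phi> f = \<phi> (J.anti_part f)" for f
  proof -
    have "theta_tilde \<phi> f = \<phi> (J.anti_part (diag_part f) + J.anti_part (strict_part f))"
      by (simp add: theta_tilde_def theta_fun entry_inverse \<phi>.add J.anti_part_D diag_part_in_D)
    then show ?thesis by (simp flip: J.anti_part_add add: diag_part_add_strict_part)
  qed
  have "algebra_hom scale_fi scaleA (psi_tilde \<phi>)"
    unfolding algebra_hom_def module_hom_def module_hom_axioms_def
    using fi.module_axioms A.module_axioms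
    by (auto simp: psi J.hom_part_add J.hom_part_scale \<phi>.add \<phi>.scale simp flip: \<phi>_jm J.hom_part_jmult)
  moreover have "algebra_antihom scale_fi scaleA (theta_tilde \<phi>)"
    unfolding algebra_antihom_def module_hom_def module_hom_axioms_def
    using fi.module_axioms A.module_axioms
    by (auto simp: theta J.anti_part_add J.anti_part_scale \<phi>.add \<phi>.scale
        simp flip: \<phi>_jm J.anti_part_jmult)
  moreover have "psi_tilde \<phi> a = \<phi> a" "theta_tilde \<phi> a = \<phi> a" if "a \<in> fi_D" for a
    using that by (simp_all add: psi theta J.hom_part_D J.anti_part_D)
  moreover have "psi_tilde \<phi> a * theta_tilde \<phi> b = 0" "theta_tilde \<phi> a * psi_tilde \<phi> b = 0"
    if "a \<in> fi_FZ" "b \<in> fi_FZ" for a b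
    using that J.hom_part_jmult_anti_part[of a b] J.anti_part_jmult_hom_part[of a b]
    by (simp_all add: psi theta \<phi>.zero flip: \<phi>_jm)
  moreover have "\<phi> a = psi_tilde \<phi> a + theta_tilde \<phi> a" if "a \<in> fi_FZ" for a
    using that by (simp add: psi theta J.hom_part_add_anti_part flip: \<phi>.add)
  ultimately have "is_near_sum scale_fi scaleA fi_D fi_FZ (psi_tilde \<phi>) (theta_tilde \<phi>) \<phi>"
    using fi_D_subalgebra fi_FZ_ideal fi_D_FZ_decomposition hom
    by (simp add: is_near_sum_def)
  moreover have "(\<exists>g\<in>fi_FZ. entry g = psi_fun \<phi> f) \<and> (\<exists>h\<in>fi_FZ. entry h = theta_fun \<phi> f)"
    if "f \<in> fi_FZ" for f
    using J.hom_part_FZ[OF that] J.anti_part_FZ[OF that] psi_fun theta_fun by metis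
  ultimately show ?thesis by blast
qed

end
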